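(* For any graph $G$ and any integer $k\geq 4$, $\chi'^t_d(G^{\frac{1}{k}})\leq \chi'^t_d(G^{\frac{1}{k+1}})$.
   Context: Graphs are simple. Two edges are adjacent if they are distinct and share an endpoint. A total dominator edge coloring (TDE-coloring) of a graph $G$ is a proper edge coloring of $G$ in which each edge of $G$ is adjacent to every edge of some color class (a color class is the set of all edges assigned a given used color). The total dominator edge chromatic number $\chi'^t_d(G)$ is the minimum number of color classes in a TDE-coloring of $G$. For a positive integer $k$, the $k$-subdivision $G^{\frac{1}{k}}$ of $G$ is the graph obtained by replacing each edge of $G$ with a path of length $k$ (i.e. with $k$ edges and $k-1$ new internal vertices) between its endpoints. *)

theory Defs
  imports Main
begin

record 'a graph =
  verts :: "'a set"
  edges :: "'a set set"

definition simple_graph :: "'a graph \<Rightarrow> bool" where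
  "simple_graph G \<longleftrightarrow>
     finite (verts G) \<and> (\<forall>e \<in> edges G. e \<subseteq> verts G \<and> card e = 2)"

definition adjacent :: "'a set \<Rightarrow> 'a set \<Rightarrow> bool" where
  "adjacent e f \<longleftrightarrow> e \<noteq> f \<and> e \<inter> f \<noteq> {}"

definition proper_edge_coloring :: "'a graph \<Rightarrow> ('a set \<Rightarrow> nat) \<Rightarrow> bool" where
  "proper_edge_coloring G c \<longleftrightarrow>
     (\<forall>e \<in> edges G. \<forall>f \<in> edges G. adjacent e f \<longrightarrow> c e \<noteq> c f)"

(* Only the colors in the image of the edge set count, so every color class is nonempty. *)
definition color_classes :: "'a graph \<Rightarrow> ('a set \<Rightarrow> nat) \<Rightarrow> 'a set set set" where
  "color_classes G c = (\<lambda>a. {e \<in> edges G. c e = a}) ` (c ` edges G)"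

definition tde_coloring :: "'a graph \<Rightarrow> ('a set \<Rightarrow> nat) \<Rightarrow> bool" where
  "tde_coloring G c \<longleftrightarrow> proper_edge_coloring G c \<and>
     (\<forall>e \<in> edges G. \<exists>C \<in> color_classes G c. \<forall>f \<in> C. adjacent e f)"

(* Unspecified for a graph without a TDE-coloring, i.e. one with an edge that is adjacent to no
   other edge.  The lemma tde_coloring_subdivision_exists below rules this out for
   k-subdivisions with k >= 2. *)
definition tde_chromatic_number :: "'a graph \<Rightarrow> nat" where
  "tde_chromatic_number G = (LEAST n. \<exists>c. tde_coloring G c \<and> card (color_classes G c) = n)"

datatype 'a sub_vertex = Old 'a | New "('a \<times> nat) set"

(* The vertex at distance i from u on the path of length k that replaces the edge {u, v}.
   Recording an internal vertex by its distances to both ends makes the encoding independent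
   of the orientation of the edge (see path_vertex_sym), and distinct edges get disjoint sets
   of internal vertices. *)
definition path_vertex :: "nat \<Rightarrow> 'a \<Rightarrow> 'a \<Rightarrow> nat \<Rightarrow> 'a sub_vertex" where
  "path_vertex k u v i =
     (if i = 0 then Old u else if i = k then Old v else New {(u, i), (v, k - i)})"

definition subdivision :: "nat \<Rightarrow> 'a graph \<Rightarrow> 'a sub_vertex graph" where
  "subdivision k G =
     \<lparr>verts = Old ` verts G \<union> {path_vertex k u v i | u v i. {u, v} \<in> edges G \<and> 0 < i \<and> i < k},
      edges = {{path_vertex k u v i, path_vertex k u v (Suc i)} | u v i.
                 {u, v} \<in> edges G \<and> i < k}\<rparr>"

lemma path_vertex_sym:
  assumes "0 < k" "i \<le> k"
  shows "path_vertex k v u (k - i) = path_vertex k u v i"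
  using assms by (auto simp: path_vertex_def)

lemma path_vertex_inj:
  assumes "u \<noteq> v" "i \<le> k" "j \<le> k" "path_vertex k u v i = path_vertex k u v j"
  shows "i = j"
  using assms by (auto simp: path_vertex_def doubleton_eq_iff split: if_splits)

lemma internal_vertex_disjoint:
  assumes "u \<noteq> v" "x \<noteq> y" "0 < i" "i < k" "0 < j" "j < k"
    and "path_vertex k u v i = path_vertex k x y j"
  shows "{u, v} = {x, y}"
  using assms by (auto simp: path_vertex_def doubleton_eq_iff)

lemma simple_graph_edge_neq:
  assumes "simple_graph G" "{u, v} \<in> edges G"
  shows "u \<noteq> v" "u \<in> verts G" "v \<in> verts G"
  using assms by (auto simp: simple_graph_def)

lemma simple_graph_subdivision:
  assumes G: "simple_graph G" and k: "0 < k"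
  shows "simple_graph (subdivision k G)"
proof -
  have fin: "finite (verts G)" using G by (simp add: simple_graph_def)
  have "{path_vertex k u v i | u v i. {u, v} \<in> edges G \<and> 0 < i \<and> i < k}
      \<subseteq> (\<lambda>(u, v, i). path_vertex k u v i) ` (verts G \<times> verts G \<times> {..<k})"
    using simple_graph_edge_neq[OF G] by force
  then have "finite {path_vertex k u v i | u v i. {u, v} \<in> edges G \<and> 0 < i \<and> i < k}"
    by (rule finite_subset) (use fin in auto)
  then have 1: "finite (verts (subdivision k G))"
    using fin by (simp add: subdivision_def)
  have 2: "path_vertex k u v i \<in> verts (subdivision k G)"
    if "{u, v} \<in> edges G" "i \<le> k" for u v i
  proof (cases "i = 0 \<or> i = k")
    case True
    then show ?thesis using simple_graph_edge_neq[OF G that(1)]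
      by (auto simp: subdivision_def path_vertex_def)
  next
    case False
    then have "0 < i \<and> i < k" using that by simp
    then show ?thesis using that(1) by (force simp: subdivision_def)
  qed
  have 3: "e \<subseteq> verts (subdivision k G) \<and> card e = 2" if "e \<in> edges (subdivision k G)" for e
  proof -
    from that obtain u v i where e: "e = {path_vertex k u v i, path_vertex k u v (Suc i)}"
      and uv: "{u, v} \<in> edges G" and i: "i < k"
      by (auto simp: subdivision_def)
    have "path_vertex k u v i \<noteq> path_vertex k u v (Suc i)"
      using path_vertex_inj[OF simple_graph_edge_neq(1)[OF G uv], of i k "Suc i"] i by auto
    then show ?thesis using e 2[OF uv] i by auto
  qed
  from 1 3 show ?thesis by (simp add: simple_graph_def)
qed

lemma simple_graph_finite_edges:
  assumes "simple_graph G"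
  shows "finite (edges G)"
proof -
  have "edges G \<subseteq> Pow (verts G)" using assms by (auto simp: simple_graph_def)
  then show ?thesis using assms finite_subset by (auto simp: simple_graph_def)
qed

lemma tde_coloring_exists:
  assumes G: "simple_graph G"
    and adj: "\<And>e. e \<in> edges G \<Longrightarrow> \<exists>f \<in> edges G. adjacent e f"
  shows "\<exists>c. tde_coloring G c"
proof -
  obtain c :: "'a set \<Rightarrow> nat" where c: "inj_on c (edges G)"
    using finite_imp_inj_to_nat_seg[OF simple_graph_finite_edges[OF G]] by blast
  have "proper_edge_coloring G c"
    using c by (auto simp: proper_edge_coloring_def adjacent_def inj_on_def)
  moreover have "\<exists>C \<in> color_classes G c. \<forall>f \<in> C. adjacent e f" if e: "e \<in> edges G" for e
  proof -
    obtain f where f: "f \<in> edges G" "adjacent e f" using adj[OF e] by blast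
    have "{g \<in> edges G. c g = c f} = {f}" using c f(1) by (auto simp: inj_on_def)
    then show ?thesis using f by (auto simp: color_classes_def)
  qed
  ultimately show ?thesis by (auto simp: tde_coloring_def)
qed

lemma tde_coloring_subdivision_exists:
  assumes G: "simple_graph G" and k: "2 \<le> k"
  shows "\<exists>c. tde_coloring (subdivision k G) c"
proof (rule tde_coloring_exists)
  show "simple_graph (subdivision k G)" using simple_graph_subdivision[OF G] k by simp
next
  fix e assume "e \<in> edges (subdivision k G)"
  then obtain u v i where e: "e = {path_vertex k u v i, path_vertex k u v (Suc i)}"
    and uv: "{u, v} \<in> edges G" and i: "i < k"
    by (auto simp: subdivision_def)
  note inj = path_vertex_inj[OF simple_graph_edge_neq(1)[OF G uv], of _ k]
  define j where "j = (if i = 0 then 1 else i - 1)"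
  define f where "f = {path_vertex k u v j, path_vertex k u v (Suc j)}"
  have j: "j < k" using i k by (auto simp: j_def)
  have "f \<in> edges (subdivision k G)"
    using uv j by (auto simp: f_def subdivision_def)
  moreover have "e \<noteq> f"
  proof
    assume "e = f"
    then have "path_vertex k u v i = path_vertex k u v j \<or>
      path_vertex k u v i = path_vertex k u v (Suc j) \<and>
      path_vertex k u v (Suc i) = path_vertex k u v j"
      by (auto simp: e f_def doubleton_eq_iff)
    then have "i = j \<or> i = Suc j \<and> Suc i = j"
      using inj[of i j] inj[of i "Suc j"] inj[of "Suc i" j] i j by auto
    then show False by (auto simp: j_def split: if_splits)
  qed
  moreover have "e \<inter> f \<noteq> {}"
    by (auto simp: e f_def j_def)
  ultimately show "\<exists>f \<in> edges (subdivision k G). adjacent e f"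
    by (auto simp: adjacent_def)
qed

end

theory Submission imports Defs begin

text \<open>
  Take an optimal TDE-coloring of the \<open>(k + 1)\<close>-subdivision and contract one segment on each
  subdivided edge; the result is the \<open>k\<close>-subdivision, and the surviving segments keep their
  colors.  So no color is added, and everything depends on choosing the contracted segments well.

  Contract only segments that touch no vertex of the original graph.  If \<open>s\<close> is contracted, its
  two neighbors \<open>p\<close> and \<open>n\<close> become adjacent, and no other adjacency changes.  Two things can go
  wrong: \<open>p\<close> and \<open>n\<close> may have the same color, or the class that \<open>p\<close> or \<open>n\<close> relied on may have been
  \<open>{s}\<close>, which disappears.  The latter does no harm if \<open>{p}\<close> and \<open>{n}\<close> are color classes too,
  because \<open>p\<close> can then rely on \<open>{n}\<close> and \<open>n\<close> on \<open>{p}\<close>.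

  A harmless segment exists on every path with at least five segments (lemma
  \<open>contractible_segment_exists\<close>); this is where the bound on \<open>k\<close> comes from.  If every candidate
  among the second, third and fourth segment fails, then the colors of the first, third and
  fifth agree.  But the second segment must rely on the class of the first or the third one,
  and it is not adjacent to the fifth.
\<close>

section \<open>Color classes\<close>

lemma card_color_classes: "card (color_classes H c) = card (c ` edges H)"
  unfolding color_classes_def
  by (rule card_image) (fastforce simp: inj_on_def)

lemma tde_coloring_iff:
  "tde_coloring H c \<longleftrightarrow> proper_edge_coloring H c \<and>
     (\<forall>e \<in> edges H. \<exists>f \<in> edges H. \<forall>g \<in> edges H. c g = c f \<longrightarrow> adjacent e g)"
  unfolding tde_coloring_def color_classes_def by (simp add: Ball_def imp_conjL)

definition sole_of_color :: "'a graph \<Rightarrow> ('a set \<Rightarrow> nat) \<Rightarrow> 'a set \<Rightarrow> bool" where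
  "sole_of_color H c e \<longleftrightarrow> (\<forall>g \<in> edges H. c g = c e \<longrightarrow> g = e)"

section \<open>Coordinates for the edges of a subdivision\<close>

text \<open>
  The segments of a subdivided edge can be numbered from either end.  Contraction has to name one
  segment per edge, so an orientation is fixed once and for all; it makes the numbering unique.
\<close>

locale oriented_graph =
  fixes G :: "'a graph" and tail head :: "'a set \<Rightarrow> 'a"
  assumes simple: "simple_graph G"
    and ends: "e \<in> edges G \<Longrightarrow> {tail e, head e} = e"
begin

definition segment :: "nat \<Rightarrow> 'a set \<Rightarrow> nat \<Rightarrow> 'a sub_vertex set" where
  "segment k e i = {path_vertex k (tail e) (head e) i, path_vertex k (tail e) (head e) (Suc i)}"

definition old_ends :: "nat \<Rightarrow> 'a set \<Rightarrow> nat \<Rightarrow> 'a set" where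
  "old_ends k e i = (if i = 0 then {tail e} else {}) \<union> (if Suc i = k then {head e} else {})"

lemma tail_neq_head: "e \<in> edges G \<Longrightarrow> tail e \<noteq> head e"
  using simple_graph_edge_neq(1)[OF simple, of "tail e" "head e"] ends by auto

lemma segment_in_edges:
  "e \<in> edges G \<Longrightarrow> i < k \<Longrightarrow> segment k e i \<in> edges (subdivision k G)"
  unfolding segment_def subdivision_def using ends by fastforce

lemma edge_is_segment:
  assumes "x \<in> edges (subdivision k G)"
  obtains e i where "e \<in> edges G" "i < k" "x = segment k e i"
proof -
  obtain u v i where x: "x = {path_vertex k u v i, path_vertex k u v (Suc i)}"
    and uv: "{u, v} \<in> edges G" and i: "i < k"
    using assms by (auto simp: subdivision_def)
  consider "tail {u, v} = u" "head {u, v} = v" | "tail {u, v} = v" "head {u, v} = u"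
    using ends[OF uv] by (auto simp: doubleton_eq_iff)
  then show thesis
  proof cases
    case 1
    then show thesis using that[OF uv i] x by (simp add: segment_def)
  next
    case 2
    have k: "k - Suc (k - Suc i) = i" "k - (k - Suc i) = Suc i" using i by auto
    have "x = segment k {u, v} (k - Suc i)"
      using x 2 i path_vertex_sym[of k "k - Suc i" u v] path_vertex_sym[of k "Suc (k - Suc i)" u v]
        path_vertex_sym[of k i u v] path_vertex_sym[of k "Suc i" u v]
      by (auto simp: segment_def Suc_diff_Suc)
    then show thesis using that[OF uv, of "k - Suc i"] i by auto
  qed
qed

text \<open>
  Paths that replace different edges have no interior vertex in common, so their segments can
  only meet in vertices of \<open>G\<close>.
\<close>

lemma segments_meet_iff:
  assumes "e \<in> edges G" "f \<in> edges G" "i < k" "l < k"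
  shows "segment k e i \<inter> segment k f l \<noteq> {} \<longleftrightarrow>
    (if e = f then i = l \<or> l = Suc i \<or> i = Suc l else old_ends k e i \<inter> old_ends k f l \<noteq> {})"
proof (cases "e = f")
  case True
  have "path_vertex k (tail e) (head e) p = path_vertex k (tail e) (head e) q \<longleftrightarrow> p = q"
    if "p \<le> k" "q \<le> k" for p q
    using path_vertex_inj[OF tail_neq_head[OF assms(1)] that] by blast
  then show ?thesis
    using True assms(3,4) by (auto simp: segment_def)
next
  case False
  have meet: "path_vertex k (tail e) (head e) p = path_vertex k (tail f) (head f) q \<longleftrightarrow>
      (p = 0 \<and> q = 0 \<and> tail e = tail f \<or> p = 0 \<and> q = k \<and> tail e = head f \<or>
       p = k \<and> q = 0 \<and> head e = tail f \<or> p = k \<and> q = k \<and> head e = head f)"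
    if bounds: "p \<le> k" "q \<le> k" for p q
  proof (cases "0 < p \<and> p < k \<and> 0 < q \<and> q < k")
    case True
    then have "path_vertex k (tail e) (head e) p \<noteq> path_vertex k (tail f) (head f) q"
      using internal_vertex_disjoint[OF tail_neq_head[OF assms(1)] tail_neq_head[OF assms(2)],
          of p k q] ends[OF assms(1)] ends[OF assms(2)] \<open>e \<noteq> f\<close> by metis
    then show ?thesis using True by simp
  next
    case False
    then consider "p = 0" | "p = k" | "q = 0" "0 < p" "p < k" | "q = k" "0 < p" "p < k"
      using bounds by (metis le_neq_implies_less neq0_conv)
    then show ?thesis using assms(3) by cases (simp_all add: path_vertex_def)
  qed
  have "segment k e i \<inter> segment k f l \<noteq> {} \<longleftrightarrow>
      (\<exists>p \<in> {i, Suc i}. \<exists>q \<in> {l, Suc l}.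
        path_vertex k (tail e) (head e) p = path_vertex k (tail f) (head f) q)"
    by (auto simp: segment_def)
  also have "\<dots> \<longleftrightarrow> old_ends k e i \<inter> old_ends k f l \<noteq> {}"
    using assms(3,4) by (auto simp: meet old_ends_def)
  finally show ?thesis using False by simp
qed

text \<open>
  As soon as a path has two segments, each of them has an interior vertex, and that vertex
  determines the subdivided edge.
\<close>

lemma segment_eq_iff:
  assumes "e \<in> edges G" "f \<in> edges G" "i < k" "l < k" "2 \<le> k"
  shows "segment k e i = segment k f l \<longleftrightarrow> e = f \<and> i = l"
proof
  assume eq: "segment k e i = segment k f l"
  have "e = f"
  proof (rule ccontr)
    assume neq: "e \<noteq> f"
    define p where "p = (if i = 0 then 1 else i)"
    have p: "0 < p" "p < k" "path_vertex k (tail e) (head e) p \<in> segment k e i"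
      using assms(3,5) by (auto simp: p_def segment_def)
    then obtain q where q: "q \<le> k"
      "path_vertex k (tail e) (head e) p = path_vertex k (tail f) (head f) q"
      using eq assms(4) unfolding segment_def by (metis insertE singletonD less_imp_le Suc_leI)
    then have "0 < q" "q < k" using p by (auto simp: path_vertex_def split: if_splits)
    then show False
      using internal_vertex_disjoint[OF tail_neq_head[OF assms(1)] tail_neq_head[OF assms(2)],
          of p k q] p q ends[OF assms(1)] ends[OF assms(2)] neq by metis
  qed
  moreover have "i = l"
  proof -
    note inj = path_vertex_inj[OF tail_neq_head[OF assms(1)], of _ k]
    show ?thesis
      using eq \<open>e = f\<close> assms inj[of i l] inj[of "Suc i" l] inj[of i "Suc l"]
      by (auto simp: segment_def doubleton_eq_iff)
  qed
  ultimately show "e = f \<and> i = l" by simp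
qed simp

lemma adjacent_segments_iff:
  assumes "e \<in> edges G" "f \<in> edges G" "i < k" "l < k" "2 \<le> k"
  shows "adjacent (segment k e i) (segment k f l) \<longleftrightarrow>
    (if e = f then l = Suc i \<or> i = Suc l else old_ends k e i \<inter> old_ends k f l \<noteq> {})"
  using segments_meet_iff[OF assms(1-4)] segment_eq_iff[OF assms]
  by (auto simp: adjacent_def)

section \<open>Segments that can be contracted\<close>

text \<open>
  The two ways in which contraction of an interior segment can fail are excluded here: equal
  colors on its two neighbors, and the loss of a class on which a neighbor relies.
\<close>

definition contractible :: "nat \<Rightarrow> ('a sub_vertex set \<Rightarrow> nat) \<Rightarrow> 'a set \<Rightarrow> nat \<Rightarrow> bool" where
  "contractible m c e j \<longleftrightarrow> 0 < j \<and> Suc j < m \<and>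
     c (segment m e (j - 1)) \<noteq> c (segment m e (Suc j)) \<and>
     (sole_of_color (subdivision m G) c (segment m e j) \<longrightarrow>
       sole_of_color (subdivision m G) c (segment m e (j - 1)) \<and>
       sole_of_color (subdivision m G) c (segment m e (Suc j)))"

text \<open>
  If one of the segments 1, 2, 3 is not alone in its color, then non-contractibility makes the
  two neighbors of that segment agree in color, hence not alone either, and this spreads to all
  three.  Then segments 0, 2 and 4 share a color, and no class consists of neighbors of segment 1.
  If all three are alone in their colors, segment 2 is contractible.
\<close>

lemma contractible_segment_exists:
  assumes tde: "tde_coloring (subdivision m G) c" and m: "5 \<le> m" and e: "e \<in> edges G"
  shows "\<exists>j. contractible m c e j"
proof (rule ccontr)
  assume none: "\<not> ?thesis"
  let ?s = "segment m e"
  let ?sole = "\<lambda>i. sole_of_color (subdivision m G) c (?s i)"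
  have differ: "c (?s i) \<noteq> c (?s l)" if "?sole i \<or> ?sole l" "i < m" "l < m" "i \<noteq> l" for i l
    using that segment_eq_iff[OF e e, of i m l] segment_in_edges[OF e, of i m]
      segment_in_edges[OF e, of l m] m
    by (auto simp: sole_of_color_def)
  have bad: "c (?s (j - 1)) = c (?s (Suc j)) \<or> ?sole j \<and> \<not> (?sole (j - 1) \<and> ?sole (Suc j))"
    if "0 < j" "Suc j < m" for j
    using none that by (auto simp: contractible_def)
  have b1: "c (?s 0) = c (?s 2) \<or> ?sole 1" using bad[of 1] m by (auto simp: numeral_2_eq_2)
  have b2: "c (?s 1) = c (?s 3) \<or> ?sole 2 \<and> \<not> (?sole 1 \<and> ?sole 3)"
    using bad[of 2] m by (auto simp: eval_nat_numeral)
  have b3: "c (?s 2) = c (?s 4) \<or> ?sole 3" using bad[of 3] m by (auto simp: eval_nat_numeral)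
  have "c (?s 0) = c (?s 2)" "c (?s 2) = c (?s 4)"
    using b1 b2 b3 differ[of 1 3] differ[of 0 2] differ[of 2 4] m by auto
  moreover obtain h where h: "h \<in> edges (subdivision m G)"
    "\<forall>g \<in> edges (subdivision m G). c g = c h \<longrightarrow> adjacent (?s 1) g"
    using tde segment_in_edges[OF e, of 1 m] m unfolding tde_coloring_iff by force
  moreover have "c h = c (?s 0) \<or> c h = c (?s 2)"
  proof -
    obtain f l where f: "f \<in> edges G" "l < m" "h = segment m f l"
      using edge_is_segment[OF h(1)] by blast
    have "adjacent (?s 1) (segment m f l)" using h f by auto
    then have "f = e \<and> (l = 0 \<or> l = 2)"
      using adjacent_segments_iff[OF e f(1), of 1 m l] f(2) m
      by (auto simp: old_ends_def split: if_splits)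
    then show ?thesis using f by auto
  qed
  ultimately have "adjacent (?s 1) (?s 4)" using segment_in_edges[OF e, of 4 m] m by auto
  then show False using adjacent_segments_iff[OF e e, of 1 m 4] m by auto
qed

section \<open>Contraction\<close>

text \<open>
  Segment \<open>i\<close> of a contracted path is segment \<open>skip j i\<close> of the original path if \<open>j\<close> is the
  contracted one.
\<close>

definition skip :: "nat \<Rightarrow> nat \<Rightarrow> nat" where
  "skip j i = (if i < j then i else Suc i)"

lemma skip_less: "i < k \<Longrightarrow> skip j i < Suc k"
  by (simp add: skip_def)

lemma skip_onto:
  assumes "l < Suc k" "l \<noteq> j" "j < k"
  obtains i where "i < k" "l = skip j i"
proof (cases "l < j")
  case True
  then show thesis using that[of l] assms by (simp add: skip_def)
next
  case False
  then show thesis using that[of "l - 1"] assms by (auto simp: skip_def)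
qed

lemma skip_consecutiveD: "skip j l = Suc (skip j i) \<Longrightarrow> l = Suc i"
  by (auto simp: skip_def split: if_splits)

lemma skip_consecutive:
  "0 < j \<Longrightarrow> l = Suc i \<Longrightarrow>
    skip j l = Suc (skip j i) \<or> skip j i = j - 1 \<and> skip j l = Suc j"
  by (auto simp: skip_def)

lemma old_ends_skip:
  "0 < j \<Longrightarrow> j < k \<Longrightarrow> i < k \<Longrightarrow> old_ends (Suc k) e (skip j i) = old_ends k e i"
  by (auto simp: old_ends_def skip_def)

lemma contraction_keeps_adjacency:
  assumes "e \<in> edges G" "f \<in> edges G" "i < k" "l < k" "2 \<le> k"
    and "0 < J e" "J e < k" "0 < J f" "J f < k"
    and "adjacent (segment (Suc k) e (skip (J e) i)) (segment (Suc k) f (skip (J f) l))"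
  shows "adjacent (segment k e i) (segment k f l)"
proof -
  note old = adjacent_segments_iff[OF assms(1-5)]
  note new = adjacent_segments_iff[OF assms(1,2) skip_less[OF assms(3)] skip_less[OF assms(4)],
    of "J e" "J f"]
  show ?thesis
  proof (cases "e = f")
    case True
    then show ?thesis using assms(5,10) old new
        skip_consecutiveD[of "J e" l i] skip_consecutiveD[of "J e" i l]
      by auto
  next
    case False
    then show ?thesis using assms(5,10) old new
        old_ends_skip[OF assms(6,7,3), of e] old_ends_skip[OF assms(8,9,4), of f]
      by simp
  qed
qed

text \<open>
  Contracting an interior segment leaves everything at the vertices of \<open>G\<close> as it is, so the only
  new adjacency is between the two neighbors of the contracted segment.
\<close>

lemma contraction_new_adjacency:
  assumes "e \<in> edges G" "f \<in> edges G" "i < k" "l < k" "2 \<le> k"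
    and "0 < J e" "J e < k" "0 < J f" "J f < k"
    and "adjacent (segment k e i) (segment k f l)"
  shows "adjacent (segment (Suc k) e (skip (J e) i)) (segment (Suc k) f (skip (J f) l)) \<or>
    e = f \<and> {skip (J e) i, skip (J f) l} = {J e - 1, Suc (J e)}"
proof -
  note old = adjacent_segments_iff[OF assms(1-5)]
  note new = adjacent_segments_iff[OF assms(1,2) skip_less[OF assms(3)] skip_less[OF assms(4)],
    of "J e" "J f"]
  show ?thesis
  proof (cases "e = f")
    case True
    then show ?thesis using assms(5,10) old new
        skip_consecutive[OF assms(6), of l i] skip_consecutive[OF assms(6), of i l]
      by auto
  next
    case False
    then show ?thesis using assms(5,10) old new
        old_ends_skip[OF assms(6,7,3), of e] old_ends_skip[OF assms(8,9,4), of f]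
      by simp
  qed
qed

text \<open>
  A segment keeps the class on which it relied unless that class was the singleton of a contracted
  neighbor; it then relies on the segment on the other side of this neighbor, which is alone in
  its color by the choice of the contracted segment.
\<close>

lemma contracted_tde_coloring:
  assumes tde: "tde_coloring (subdivision (Suc k) G) c" and k: "2 \<le> k"
    and J: "\<And>e. e \<in> edges G \<Longrightarrow> contractible (Suc k) c e (J e)"
    and c': "\<And>e i. e \<in> edges G \<Longrightarrow> i < k \<Longrightarrow>
      c' (segment k e i) = c (segment (Suc k) e (skip (J e) i))"
  shows "tde_coloring (subdivision k G) c'"
proof -
  let ?m = "Suc k"
  let ?H = "subdivision ?m G"
  have J0: "0 < J e" "J e < k" if "e \<in> edges G" for e
    using J[OF that] by (auto simp: contractible_def)
  have lift_in: "segment ?m e (skip (J e) i) \<in> edges ?H" if "e \<in> edges G" "i < k" for e i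
    by (rule segment_in_edges[OF that(1) skip_less[OF that(2)]])
  note keep = contraction_keeps_adjacency[of _ _ _ k _ J, OF _ _ _ _ k]
  have "proper_edge_coloring (subdivision k G) c'"
    unfolding proper_edge_coloring_def
  proof (intro ballI impI)
    fix x y
    assume x: "x \<in> edges (subdivision k G)" and y: "y \<in> edges (subdivision k G)"
      and xy: "adjacent x y"
    obtain e i where e: "e \<in> edges G" "i < k" "x = segment k e i"
      using edge_is_segment[OF x] by blast
    obtain f l where f: "f \<in> edges G" "l < k" "y = segment k f l"
      using edge_is_segment[OF y] by blast
    let ?x = "segment ?m e (skip (J e) i)" and ?y = "segment ?m f (skip (J f) l)"
    have "adjacent ?x ?y \<or> e = f \<and> {skip (J e) i, skip (J f) l} = {J e - 1, Suc (J e)}"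
      using contraction_new_adjacency[of e f i k l J] e f k J0 xy by auto
    then have "c ?x \<noteq> c ?y"
    proof
      assume "adjacent ?x ?y"
      then show ?thesis
        using tde lift_in e f by (auto simp: tde_coloring_def proper_edge_coloring_def)
    next
      assume "e = f \<and> {skip (J e) i, skip (J f) l} = {J e - 1, Suc (J e)}"
      then show ?thesis using J[OF e(1)] by (auto simp: contractible_def doubleton_eq_iff)
    qed
    then show "c' x \<noteq> c' y" using c' e f by simp
  qed
  moreover have "\<exists>y \<in> edges (subdivision k G). \<forall>z \<in> edges (subdivision k G).
      c' z = c' y \<longrightarrow> adjacent x z" if x: "x \<in> edges (subdivision k G)" for x
  proof -
    obtain e i where e: "e \<in> edges G" "i < k" "x = segment k e i"
      using edge_is_segment[OF x] by blast
    let ?s = "skip (J e) i"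
    have s: "?s < ?m" by (rule skip_less[OF e(2)])
    obtain h where h: "h \<in> edges ?H"
      "\<And>g. g \<in> edges ?H \<Longrightarrow> c g = c h \<Longrightarrow> adjacent (segment ?m e ?s) g"
      using tde lift_in[OF e(1,2)] unfolding tde_coloring_iff by blast
    show ?thesis
    proof (cases "\<exists>f l. f \<in> edges G \<and> l < k \<and> c (segment ?m f (skip (J f) l)) = c h")
      case True
      \<comment> \<open>The class survives contraction, possibly smaller.\<close>
      then obtain f l where f: "f \<in> edges G" "l < k" "c (segment ?m f (skip (J f) l)) = c h"
        by blast
      have "adjacent x z" if z: "z \<in> edges (subdivision k G)" "c' z = c' (segment k f l)" for z
      proof -
        obtain f' l' where f': "f' \<in> edges G" "l' < k" "z = segment k f' l'"
          using edge_is_segment[OF z(1)] by blast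
        have "adjacent (segment ?m e ?s) (segment ?m f' (skip (J f') l'))"
          by (rule h(2)) (use lift_in f f' z(2) c' in auto)
        then show ?thesis using keep[of e f' i l'] e f' J0 by auto
      qed
      then show ?thesis using segment_in_edges[OF f(1,2)] by blast
    next
      case False
      \<comment> \<open>The class consists of contracted segments.  Since these are interior, only one of them is
        adjacent to any given segment.\<close>
      have vanished: "g = segment ?m e (J e) \<and> (?s = Suc (J e) \<or> J e = Suc ?s)"
        if g: "g \<in> edges ?H" "c g = c h" for g
      proof -
        obtain f l where f: "f \<in> edges G" "l < ?m" "g = segment ?m f l"
          using edge_is_segment[OF g(1)] by blast
        have l: "l = J f"
          using skip_onto[OF f(2), of "J f"] J0[OF f(1)] False f g(2) by metis
        have "adjacent (segment ?m e ?s) (segment ?m f l)" using h(2)[OF g] f by simp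
        then show ?thesis
          using adjacent_segments_iff[OF e(1) f(1) s f(2)] J0[OF f(1)] k l f(3)
          by (auto simp: old_ends_def split: if_splits)
      qed
      have "sole_of_color ?H c (segment ?m e (J e))"
        using vanished h(1) by (metis sole_of_color_def)
      then have sole: "sole_of_color ?H c (segment ?m e (J e - 1))"
        "sole_of_color ?H c (segment ?m e (Suc (J e)))"
        using J[OF e(1)] by (auto simp: contractible_def)
      \<comment> \<open>The neighbor across the contracted segment: \<open>J e - 1\<close> and \<open>J e\<close> are the indices, after
        contraction, of the segments on its two sides.\<close>
      define l where "l = (if i < J e then J e else J e - 1)"
      have il: "l = Suc i \<or> i = Suc l"
        using vanished[OF h(1)] J0[OF e(1)] by (auto simp: l_def skip_def split: if_splits)
      have l: "l < k" using J0[OF e(1)] by (auto simp: l_def)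
      have sole_l: "sole_of_color ?H c (segment ?m e (skip (J e) l))"
        using sole J0[OF e(1)] by (auto simp: l_def skip_def)
      have "adjacent x z" if z: "z \<in> edges (subdivision k G)" "c' z = c' (segment k e l)" for z
      proof -
        obtain f' l' where f': "f' \<in> edges G" "l' < k" "z = segment k f' l'"
          using edge_is_segment[OF z(1)] by blast
        have "segment ?m f' (skip (J f') l') = segment ?m e (skip (J e) l)"
          using sole_l lift_in f' z(2) c' e(1) l by (auto simp: sole_of_color_def)
        then have "f' = e \<and> skip (J f') l' = skip (J e) l"
          using segment_eq_iff[OF f'(1) e(1) skip_less[OF f'(2)] skip_less[OF l]] k by auto
        then have "f' = e" "l' = l" by (auto simp: skip_def split: if_splits)
        then show ?thesis using adjacent_segments_iff[OF e(1) e(1) e(2) l k] il e(3) f'(3) by auto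
      qed
      then show ?thesis using segment_in_edges[OF e(1) l] by blast
    qed
  qed
  ultimately show ?thesis by (simp add: tde_coloring_iff)
qed

lemma contracted_coloring_exists:
  assumes tde: "tde_coloring (subdivision (Suc k) G) c" and k: "4 \<le> k"
  shows "\<exists>c'. tde_coloring (subdivision k G) c' \<and>
    card (color_classes (subdivision k G) c') \<le> card (color_classes (subdivision (Suc k) G) c)"
proof -
  obtain J where J: "\<And>e. e \<in> edges G \<Longrightarrow> contractible (Suc k) c e (J e)"
    using contractible_segment_exists[OF tde] k by (metis Suc_le_mono eval_nat_numeral(3))
  define coords where "coords = inv_into (edges G \<times> {..<k}) (\<lambda>(e, i). segment k e i)"
  define c' where "c' = (\<lambda>x. case coords x of (e, i) \<Rightarrow> c (segment (Suc k) e (skip (J e) i)))"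
  have inj: "inj_on (\<lambda>(e, i). segment k e i) (edges G \<times> {..<k})"
    using segment_eq_iff[of _ _ _ k] k by (auto simp: inj_on_def)
  have c': "c' (segment k e i) = c (segment (Suc k) e (skip (J e) i))"
    if "e \<in> edges G" "i < k" for e i
    using inv_into_f_f[OF inj, of "(e, i)"] that by (simp add: c'_def coords_def)
  have "c' ` edges (subdivision k G) \<subseteq> c ` edges (subdivision (Suc k) G)"
  proof
    fix a assume "a \<in> c' ` edges (subdivision k G)"
    then obtain e i where "e \<in> edges G" "i < k" "a = c' (segment k e i)"
      using edge_is_segment by blast
    then show "a \<in> c ` edges (subdivision (Suc k) G)"
      using c' segment_in_edges[OF _ skip_less] by auto
  qed
  moreover have "finite (edges (subdivision (Suc k) G))"
    using simple_graph_finite_edges[OF simple_graph_subdivision[OF simple]] by simp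
  ultimately have "card (c' ` edges (subdivision k G)) \<le> card (c ` edges (subdivision (Suc k) G))"
    by (intro card_mono) auto
  moreover have "tde_coloring (subdivision k G) c'"
    using contracted_tde_coloring[OF tde _ J c'] k by auto
  ultimately show ?thesis by (auto simp: card_color_classes)
qed

end

lemma orientation_exists:
  assumes "simple_graph G"
  obtains tail head where "oriented_graph G tail head"
proof -
  have "\<forall>e \<in> edges G. \<exists>u v. {u, v} = e"
    using assms by (metis simple_graph_def card_2_iff)
  then show thesis using that assms by (metis oriented_graph.intro)
qed

theorem theorem4p8:
  fixes G :: "'a graph" and k :: nat
  assumes "simple_graph G" and "k \<ge> 4"
  shows "tde_chromatic_number (subdivision k G) \<le> tde_chromatic_number (subdivision (k + 1) G)"
proof -
  obtain tail head where "oriented_graph G tail head"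
    using orientation_exists[OF assms(1)] .
  then interpret oriented_graph G tail head .
  let ?H = "subdivision (Suc k) G"
  have "\<exists>n c. tde_coloring ?H c \<and> card (color_classes ?H c) = n"
    using tde_coloring_subdivision_exists[OF assms(1), of "Suc k"] assms(2) by auto
  then obtain c where c: "tde_coloring ?H c" "card (color_classes ?H c) = tde_chromatic_number ?H"
    unfolding tde_chromatic_number_def by (rule LeastI_ex[THEN exE]) blast
  obtain c' where c': "tde_coloring (subdivision k G) c'"
    "card (color_classes (subdivision k G) c') \<le> tde_chromatic_number ?H"
    using contracted_coloring_exists[OF c(1) assms(2)] c(2) by auto
  have "tde_chromatic_number (subdivision k G) \<le> card (color_classes (subdivision k G) c')"
    unfolding tde_chromatic_number_def by (rule Least_le) (use c'(1) in blast)
  then show ?thesis using c'(2) by simp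
qed

end
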